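(* Let $\Phi$ be any Max-Weight matching policy with parameter $\beta>0$. Then $\Phi$ is maximal: for any connected multigraph $G$ that is not a bipartite graph, $\mathrm{Stab}(G,\Phi)=\mathrm{Ncond}(G)$.
   Context: A multigraph $G=(V,E)$ has a finite node set $V$ and a set $E$ of edges, each edge joining two distinct nodes or being a self-loop at a node; there are no parallel edges. Write $u - v$ if $u,v$ are joined by an edge ($u-u$ meaning a self-loop at $u$). $V_1=\{u: u-u\}$, $V_2=V\setminus V_1$. For $U\subset V$, $E(U)=\{v\in V:\exists u\in U,\ u-v\}$. An independent set of $G$ is a nonempty set of nodes containing no edge of $G$ (in particular no node with a self-loop); $\mathbb I(G)$ is the set of independent sets. A bipartite graph is a multigraph with no self-loop that is bipartite in the usual sense. $\mathscr M(V)$ is the set of probability measures on $V$ with full support, and $\mathrm{Ncond}(G)=\{\mu\in\mathscr M(V):\ \mu(I)<\mu(E(I))\ \ \forall I\in\mathbb I(G)\}$. Matching model $(G,\Phi,\mu)$: at each time $n\ge1$ one item enters, with class $C_n\in V$, $(C_n)$ i.i.d. of law $\mu$. If the buffer contains an item of a class in $E(\{C_n\})$, the incoming item is matched with one such item chosen by the policy $\Phi$ and both leave immediately; otherwise it is stored. $W_n$ is the word over $V$ listing the classes of unmatched items after the arrival at time $n$, in order of arrival; $(W_n)$ is a Markov chain on the set of finite words $w$ over $V$ such that $|w|_i|w|_j=0$ for all distinct $i,j$ with $i-j$, and $|w|_i\le1$ for $i\in V_1$. The model is stable if $(W_n)$ is positive recurrent; $\mathrm{Stab}(G,\Phi)$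 is the set of $\mu\in\mathscr M(V)$ for which it is stable. Max-Weight policy with parameter $\beta\in\mathbb R$: a fixed real reward $w_S$ is attached to each edge $S\in E$. If $x(i)$ denotes the number of stored items of class $i$ and the incoming item has class $v$, it is matched along an edge $S\ni v$ maximizing $\beta\,x(S)+w_S$, where $x(S)=\sum_{i\in S}x(i)$, among the edges $S\ni v$ whose other endpoint $j$ ($j=v$ if $S$ is a self-loop) satisfies $x(j)>0$; ties are broken uniformly at random, and within the chosen class the oldest item is used. *)

theory Defs
  imports "HOL-Probability.Probability"
begin

section \<open>Multigraphs\<close>

text \<open>An edge is the set of its endpoints, so that a self-loop at \<open>u\<close> is the singleton \<open>{u}\<close> and
  there are no parallel edges.\<close>

record 'v multigraph =
  nodes :: "'v set"
  edges :: "'v set set"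

definition multigraph :: "'v multigraph \<Rightarrow> bool" where
  "multigraph G \<longleftrightarrow> finite (nodes G) \<and>
     (\<forall>S\<in>edges G. S \<subseteq> nodes G \<and> (card S = 1 \<or> card S = 2))"

definition adj :: "'v multigraph \<Rightarrow> 'v \<Rightarrow> 'v \<Rightarrow> bool" where
  "adj G u v \<longleftrightarrow> {u, v} \<in> edges G"

definition loop_nodes :: "'v multigraph \<Rightarrow> 'v set" where
  "loop_nodes G = {u \<in> nodes G. adj G u u}"

definition nbhd :: "'v multigraph \<Rightarrow> 'v set \<Rightarrow> 'v set" where
  "nbhd G U = {v \<in> nodes G. \<exists>u\<in>U. adj G u v}"

definition connected_multigraph :: "'v multigraph \<Rightarrow> bool" where
  "connected_multigraph G \<longleftrightarrow> nodes G \<noteq> {} \<and>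
     (\<forall>u\<in>nodes G. \<forall>v\<in>nodes G. (u, v) \<in> {(a, b). adj G a b}\<^sup>*)"

definition bipartite_graph :: "'v multigraph \<Rightarrow> bool" where
  "bipartite_graph G \<longleftrightarrow> loop_nodes G = {} \<and>
     (\<exists>A B. A \<union> B = nodes G \<and> A \<inter> B = {} \<and> (\<forall>S\<in>edges G. \<exists>a\<in>A. \<exists>b\<in>B. S = {a, b}))"

definition independent_sets :: "'v multigraph \<Rightarrow> 'v set set" where
  "independent_sets G = {I. I \<noteq> {} \<and> I \<subseteq> nodes G \<and> (\<forall>S\<in>edges G. \<not> S \<subseteq> I)}"

definition full_support_measures :: "'v multigraph \<Rightarrow> 'v pmf set" where
  "full_support_measures G = {\<mu>. set_pmf \<mu> = nodes G}"

definition Ncond :: "'v multigraph \<Rightarrow> 'v pmf set" where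
  "Ncond G = {\<mu> \<in> full_support_measures G.
     \<forall>I\<in>independent_sets G. measure_pmf.prob \<mu> I < measure_pmf.prob \<mu> (nbhd G I)}"

section \<open>Positive recurrence\<close>

text \<open>Law of \<open>(X\<^sub>1, \<dots>, X\<^sub>n)\<close> for the Markov chain with transition kernel \<open>K\<close> and \<open>X\<^sub>0 = x\<close>.\<close>

primrec trajectory :: "('a \<Rightarrow> 'a pmf) \<Rightarrow> nat \<Rightarrow> 'a \<Rightarrow> 'a list pmf" where
  "trajectory K 0 x = return_pmf []"
| "trajectory K (Suc n) x = bind_pmf (K x) (\<lambda>y. map_pmf ((#) y) (trajectory K n y))"

text \<open>Probability, starting from \<open>x\<close>, that the first return time
  \<open>T = inf {k \<ge> 1. X\<^sub>k = x}\<close> equals \<open>n\<close>; it is \<open>0\<close> for \<open>n = 0\<close>.\<close>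

definition first_return_prob :: "('a \<Rightarrow> 'a pmf) \<Rightarrow> 'a \<Rightarrow> nat \<Rightarrow> real" where
  "first_return_prob K x n =
     measure_pmf.prob (trajectory K n x) {xs. xs \<noteq> [] \<and> last xs = x \<and> x \<notin> set (butlast xs)}"

text \<open>\<open>T\<close> is almost surely finite and has finite expectation.\<close>

definition positive_recurrent_state :: "('a \<Rightarrow> 'a pmf) \<Rightarrow> 'a \<Rightarrow> bool" where
  "positive_recurrent_state K x \<longleftrightarrow>
     first_return_prob K x sums 1 \<and> summable (\<lambda>n. real n * first_return_prob K x n)"

definition positive_recurrent_on :: "'a set \<Rightarrow> ('a \<Rightarrow> 'a pmf) \<Rightarrow> bool" where
  "positive_recurrent_on X K \<longleftrightarrow> (\<forall>x\<in>X. positive_recurrent_state K x)"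

section \<open>Matching models\<close>

text \<open>A buffer is the word of the classes of the stored items, oldest first. A policy maps a buffer
  and the class of an incoming item having a compatible stored item to the (random) position in the
  buffer of the item that it is matched with.\<close>

type_synonym 'v policy = "'v list \<Rightarrow> 'v \<Rightarrow> nat pmf"

definition buffers :: "'v multigraph \<Rightarrow> 'v list set" where
  "buffers G = {b. set b \<subseteq> nodes G \<and>
     (\<forall>i j. i \<noteq> j \<and> adj G i j \<longrightarrow> count_list b i * count_list b j = 0) \<and>
     (\<forall>i\<in>loop_nodes G. count_list b i \<le> 1)}"

definition matching_kernel :: "'v multigraph \<Rightarrow> 'v policy \<Rightarrow> 'v pmf \<Rightarrow> 'v list \<Rightarrow> 'v list pmf" where
  "matching_kernel G \<Phi> \<mu> b = bind_pmf \<mu> (\<lambda>v.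
     if set b \<inter> nbhd G {v} \<noteq> {}
     then map_pmf (\<lambda>k. take k b @ drop (Suc k) b) (\<Phi> b v)
     else return_pmf (b @ [v]))"

definition Stab :: "'v multigraph \<Rightarrow> 'v policy \<Rightarrow> 'v pmf set" where
  "Stab G \<Phi> = {\<mu> \<in> full_support_measures G.
     positive_recurrent_on (buffers G) (matching_kernel G \<Phi> \<mu>)}"

section \<open>Max-Weight policies\<close>

text \<open>In \<open>S = {v, j}\<close> the class \<open>j\<close> is the other endpoint of \<open>S\<close>, with \<open>j = v\<close> for a self-loop.\<close>

definition available_edges :: "'v multigraph \<Rightarrow> 'v list \<Rightarrow> 'v \<Rightarrow> 'v set set" where
  "available_edges G b v = {S \<in> edges G. \<exists>j. S = {v, j} \<and> count_list b j > 0}"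

definition edge_weight :: "real \<Rightarrow> ('v set \<Rightarrow> real) \<Rightarrow> 'v list \<Rightarrow> 'v set \<Rightarrow> real" where
  "edge_weight \<beta> w b S = \<beta> * real (\<Sum>i\<in>S. count_list b i) + w S"

definition max_weight_edges ::
    "'v multigraph \<Rightarrow> real \<Rightarrow> ('v set \<Rightarrow> real) \<Rightarrow> 'v list \<Rightarrow> 'v \<Rightarrow> 'v set set" where
  "max_weight_edges G \<beta> w b v = {S \<in> available_edges G b v.
     \<forall>S'\<in>available_edges G b v. edge_weight \<beta> w b S' \<le> edge_weight \<beta> w b S}"

definition max_weight :: "'v multigraph \<Rightarrow> real \<Rightarrow> ('v set \<Rightarrow> real) \<Rightarrow> 'v policy" where
  "max_weight G \<beta> w b v =
     map_pmf (\<lambda>S. LEAST k. k < length b \<and> S = {v, b ! k}) (pmf_of_set (max_weight_edges G \<beta> w b v))"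

end

theory Submission
  imports Defs
begin

text \<open>Both inclusions come from a real function of the buffer whose mean one-step change is controlled,
  and from two criteria about Markov chains that are proved from first passage probabilities alone.

  \<^emph>\<open>The condition is sufficient.\<close> Let \<open>L\<close> be the sum of the squares of the queue lengths \<open>x v\<close>. An
  arrival of class \<open>v\<close> adds about \<open>2 x v\<close> to \<open>L\<close> if it is stored, and subtracts about \<open>2 x j\<close> if it is
  matched with class \<open>j\<close>. Since \<open>\<beta> > 0\<close> and the rewards are bounded, Max-Weight picks a neighbouring
  queue that is the longest one up to a constant (\<open>max_weight_greedy\<close>), so up to a constant the mean
  change of \<open>L\<close> is at most twice
  \<open>\<Sum>v. \<mu> v * x v - \<Sum>v. \<mu> v * (longest neighbouring queue of v)\<close>. Away from the self-loops, whose queues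
  have length at most \<open>1\<close>, every level set \<open>{v. x v \<ge> t}\<close> is independent, and its neighbourhood is the
  corresponding level set of the longest neighbouring queue. Summing the strict inequalities
  of \<open>Ncond\<close> over the levels \<open>t\<close> bounds the difference by \<open>- \<epsilon>\<close> times the longest queue
  (\<open>Ncond_weighted\<close>). Foster's criterion (\<open>foster\<close>) then gives positive recurrence; the chain is
  irreducible because every node has a neighbour.

  \<^emph>\<open>The condition is necessary\<close>, for every matching policy. If an independent set \<open>I\<close> has
  \<open>\<mu>(I) \<ge> \<mu>(E(I))\<close>, let \<open>D\<close> be the number of stored items in \<open>I\<close> minus the number of those in \<open>E(I)\<close>.
  Matching an arrival of class \<open>v\<close> changes \<open>D\<close> by at least as much as storing it would, so \<open>D\<close> is a
  submartingale with increments bounded by \<open>1\<close>. By optional stopping at a return time of finite mean,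
  such a function is harmonic along a positive recurrent chain (\<open>submartingale_harmonic\<close>). But \<open>D\<close> is
  not harmonic: as the graph is connected and not bipartite, an edge leads from some \<open>j\<close> in \<open>E(I)\<close> to a node
  \<open>k\<close> outside \<open>I\<close>, and in the buffer \<open>[j]\<close> an arrival of class \<open>k\<close> gains strictly more than it would
  by being stored.\<close>

section \<open>First passage times of a Markov chain\<close>

text \<open>Probability that the chain started at \<open>x\<close> does not visit \<open>z\<close> at any of the times \<open>1, \<dots>, n\<close>,
  computed by conditioning on the first step.\<close>

primrec avoid_prob :: "('a \<Rightarrow> 'a pmf) \<Rightarrow> 'a \<Rightarrow> nat \<Rightarrow> 'a \<Rightarrow> real" where
  "avoid_prob K z 0 x = 1"
| "avoid_prob K z (Suc n) x =
     measure_pmf.expectation (K x) (\<lambda>y. if y = z then 0 else avoid_prob K z n y)"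

lemma avoid_prob_bounds: "0 \<le> avoid_prob K z n x \<and> avoid_prob K z n x \<le> 1"
proof (induction n arbitrary: x)
  case (Suc n)
  have "integrable (K x) (\<lambda>y. if y = z then 0 else avoid_prob K z n y)"
    by (rule measure_pmf.integrable_const_bound[where B = 1]) (use Suc in auto)
  then show ?case
    using Suc by (auto intro!: measure_pmf.integral_le_const integral_nonneg_AE)
qed simp

lemma avoid_prob_nonneg: "0 \<le> avoid_prob K z n x"
  and avoid_prob_le_1: "avoid_prob K z n x \<le> 1"
  using avoid_prob_bounds[of K z n x] by simp_all

lemma integrable_avoid_prob [simp]:
  "integrable (measure_pmf p) (\<lambda>y. if y = z then 0 else avoid_prob K z n y)"
  by (rule measure_pmf.integrable_const_bound[where B = 1])
     (auto simp: avoid_prob_nonneg avoid_prob_le_1)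

lemma avoid_prob_Suc_le: "avoid_prob K z (Suc n) x \<le> avoid_prob K z n x"
proof (induction n arbitrary: x)
  case 0
  show ?case using avoid_prob_le_1[of K z "Suc 0" x] by simp
next
  case (Suc n)
  show ?case
    unfolding avoid_prob.simps(2)[of K z "Suc n"] avoid_prob.simps(2)[of K z n x]
    by (intro integral_mono integrable_avoid_prob) (use Suc in auto)
qed

lemma avoid_prob_antimono: "m \<le> n \<Longrightarrow> avoid_prob K z n x \<le> avoid_prob K z m x"
  by (rule lift_Suc_antimono_le[where f = "\<lambda>n. avoid_prob K z n x"]) (rule avoid_prob_Suc_le)

lemma prob_bind_pmf:
  "measure_pmf.prob (bind_pmf p f) A = measure_pmf.expectation p (\<lambda>x. measure_pmf.prob (f x) A)"
proof -
  have "integrable p (\<lambda>x. measure_pmf.prob (f x) A)"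
    by (rule measure_pmf.integrable_const_bound[where B = 1]) auto
  then have "ennreal (measure_pmf.prob (bind_pmf p f) A) =
      ennreal (measure_pmf.expectation p (\<lambda>x. measure_pmf.prob (f x) A))"
    by (simp add: measure_pmf.emeasure_eq_measure[symmetric] nn_integral_eq_integral[symmetric])
  then show ?thesis by (simp add: integral_nonneg_AE)
qed

lemma trajectory_length: "xs \<in> set_pmf (trajectory K n x) \<Longrightarrow> length xs = n"
  by (induction n arbitrary: x xs) auto

text \<open>The first visit to \<open>z\<close> happens at time \<open>n + 1\<close> exactly if it has not happened by time \<open>n\<close> but has
  happened by time \<open>n + 1\<close>. Sums over return times therefore telescope, and only the tail probabilities
  \<open>avoid_prob\<close> matter from here on.\<close>

lemma prob_first_passage:
  "measure_pmf.prob (trajectory K (Suc n) x) {xs. xs \<noteq> [] \<and> last xs = z \<and> z \<notin> set (butlast xs)}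
     = avoid_prob K z n x - avoid_prob K z (Suc n) x"
proof (induction n arbitrary: x)
  case 0
  let ?A = "{xs. xs \<noteq> [] \<and> last xs = z \<and> z \<notin> set (butlast xs)}"
  have "(\<lambda>y. measure_pmf.prob (return_pmf [y]) ?A)
      = (\<lambda>y. 1 - (if y = z then 0 else avoid_prob K z 0 y))"
    by (auto simp: fun_eq_iff)
  then have "measure_pmf.prob (trajectory K (Suc 0) x) ?A
      = measure_pmf.expectation (K x) (\<lambda>y. 1 - (if y = z then 0 else avoid_prob K z 0 y))"
    by (simp add: prob_bind_pmf del: measure_return_pmf)
  also have "\<dots> = 1 - avoid_prob K z (Suc 0) x"
    by (subst Bochner_Integration.integral_diff) (auto simp del: avoid_prob.simps(1))
  finally show ?case by simp
next
  case (Suc n)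
  let ?A = "{xs. xs \<noteq> [] \<and> last xs = z \<and> z \<notin> set (butlast xs)}"
  have step: "measure_pmf.prob (trajectory K (Suc n) y) {xs. y # xs \<in> ?A} =
      (if y = z then 0 else avoid_prob K z n y) - (if y = z then 0 else avoid_prob K z (Suc n) y)"
    for y
  proof (cases "y = z")
    case True
    have "measure_pmf.prob (trajectory K (Suc n) y) {xs. y # xs \<in> ?A} = 0"
      using True by (subst measure_pmf_zero_iff) (auto dest!: trajectory_length simp del: trajectory.simps)
    with True show ?thesis by simp
  next
    case False
    have "measure_pmf.prob (trajectory K (Suc n) y) {xs. y # xs \<in> ?A}
        = measure_pmf.prob (trajectory K (Suc n) y) ?A"
      using False by (intro arg_cong[where f = "measure_pmf.prob _"]) auto
    with False Suc.IH[of y] show ?thesis by simp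
  qed
  have "measure_pmf.prob (trajectory K (Suc (Suc n)) x) ?A
      = measure_pmf.expectation (K x)
          (\<lambda>y. measure_pmf.prob (trajectory K (Suc n) y) {xs. y # xs \<in> ?A})"
    by (simp add: prob_bind_pmf vimage_def del: trajectory.simps(2) add: trajectory.simps(2)[of K "Suc n"])
  also have "\<dots> = avoid_prob K z (Suc n) x - avoid_prob K z (Suc (Suc n)) x"
    unfolding step by (subst Bochner_Integration.integral_diff) auto
  finally show ?case .
qed

lemma first_return_prob_0: "first_return_prob K z 0 = 0"
  by (simp add: first_return_prob_def)

lemma first_return_prob_Suc:
  "first_return_prob K z (Suc n) = avoid_prob K z n z - avoid_prob K z (Suc n) z"
  unfolding first_return_prob_def by (rule prob_first_passage)

lemma sum_first_return_prob: "(\<Sum>k<Suc n. first_return_prob K z k) = 1 - avoid_prob K z n z"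
  by (induction n) (auto simp: first_return_prob_0 first_return_prob_Suc simp del: avoid_prob.simps(2))

text \<open>Summation by parts: the mean of a positive integer variable is the sum of its tail probabilities,
  here for the return time truncated at \<open>n\<close>.\<close>

lemma sum_nat_first_return_prob:
  "(\<Sum>k<Suc n. real k * first_return_prob K z k)
     = (\<Sum>k<n. avoid_prob K z k z) - real n * avoid_prob K z n z"
  by (induction n)
     (auto simp: first_return_prob_Suc algebra_simps simp del: avoid_prob.simps(2))

lemma first_return_prob_nonneg: "0 \<le> first_return_prob K z n"
  by (simp add: first_return_prob_def)

lemma positive_recurrent_state_if_bounded:
  assumes "\<And>n. (\<Sum>k<n. avoid_prob K z k z) \<le> B"
  shows "positive_recurrent_state K z"
  unfolding positive_recurrent_state_def
proof
  have "summable (\<lambda>n. avoid_prob K z n z)"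
    by (rule summableI_nonneg_bounded[OF avoid_prob_nonneg assms])
  then have "(\<lambda>n. 1 - avoid_prob K z n z) \<longlonglongrightarrow> 1 - 0"
    by (intro tendsto_intros summable_LIMSEQ_zero)
  then have "(\<lambda>n. \<Sum>k<Suc n. first_return_prob K z k) \<longlonglongrightarrow> 1"
    by (simp add: sum_first_return_prob del: sum.lessThan_Suc)
  then show "first_return_prob K z sums 1"
    unfolding sums_def by (rule LIMSEQ_imp_Suc)
  show "summable (\<lambda>n. real n * first_return_prob K z n)"
  proof (rule bounded_imp_summable)
    show "(\<Sum>k\<le>n. real k * first_return_prob K z k) \<le> B" for n
      using sum_nat_first_return_prob[of K z n] assms[of n] avoid_prob_nonneg[of K z n z]
      by (simp add: lessThan_Suc_atMost) (smt (verit) mult_nonneg_nonneg of_nat_0_le_iff)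
  qed (simp add: first_return_prob_nonneg)
qed

text \<open>A tail estimate in the style of Markov's inequality: \<open>n * P(T > n)\<close> is at most the part of the
  convergent series for the mean of \<open>T\<close> beyond \<open>n\<close>.\<close>

lemma positive_recurrent_state_imp_tail:
  assumes "positive_recurrent_state K z"
  shows "(\<lambda>n. real n * avoid_prob K z n z) \<longlonglongrightarrow> 0"
proof (rule tendsto_sandwich[where f = "\<lambda>_. 0"])
  let ?f = "first_return_prob K z"
  let ?R = "\<lambda>n. \<Sum>k. real (k + Suc n) * ?f (k + Suc n)"
  have f: "?f sums 1" and s: "summable (\<lambda>n. real n * ?f n)"
    using assms by (auto simp: positive_recurrent_state_def)
  have "real n * avoid_prob K z n z \<le> ?R n" for n
  proof -
    have *: "(\<lambda>k. ?f (k + Suc n)) sums avoid_prob K z n z"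
      using sums_split_initial_segment[OF f, of "Suc n"] sum_first_return_prob[of K z n]
      by (simp del: sum.lessThan_Suc)
    have sh: "summable (\<lambda>k. real (k + Suc n) * ?f (k + Suc n))"
      using summable_ignore_initial_segment[OF s, of "Suc n"] .
    have "real n * ?f (k + Suc n) \<le> real (k + Suc n) * ?f (k + Suc n)" for k
      by (rule mult_right_mono) (auto simp: first_return_prob_nonneg)
    from sums_le[OF this sums_mult[OF *] summable_sums[OF sh]] show ?thesis .
  qed
  then show "\<forall>\<^sub>F n in sequentially. real n * avoid_prob K z n z \<le> ?R n" by simp
  show "?R \<longlonglongrightarrow> 0"
    using LIMSEQ_Suc[OF suminf_exist_split2[OF s]] .
qed (simp_all add: avoid_prob_nonneg)

section \<open>Foster's criterion\<close>

text \<open>Finite branching makes every function integrable against one step of the chain, so that Lyapunov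
  functions may be unbounded without further care.\<close>

locale finitely_branching_chain =
  fixes K :: "'a \<Rightarrow> 'a pmf" and X :: "'a set"
  assumes closed: "x \<in> X \<Longrightarrow> set_pmf (K x) \<subseteq> X"
    and finite_branching: "x \<in> X \<Longrightarrow> finite (set_pmf (K x))"
begin

lemma integrable_step: "x \<in> X \<Longrightarrow> integrable (K x) (h :: 'a \<Rightarrow> real)"
  by (intro integrable_measure_pmf_finite finite_branching)

lemma expectation_mono:
  fixes g h :: "'a \<Rightarrow> real"
  assumes "x \<in> X" and "\<And>y. y \<in> X \<Longrightarrow> y \<in> set_pmf (K x) \<Longrightarrow> g y \<le> h y"
  shows "measure_pmf.expectation (K x) g \<le> measure_pmf.expectation (K x) h"
  using assms closed by (intro integral_mono_AE integrable_step) (auto simp: AE_measure_pmf_iff)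

text \<open>If \<open>V\<close> loses at least \<open>1\<close> on average per step until \<open>z\<close> is hit, then the hitting time from \<open>x\<close> has
  mean at most \<open>V x\<close>, since \<open>V\<close> stays nonnegative; the return time to \<open>z\<close> adds one step.\<close>

lemma expected_return_time_le:
  assumes V: "\<And>x. x \<in> X \<Longrightarrow> 0 \<le> V x"
    and drift: "\<And>x. x \<in> X \<Longrightarrow> x \<noteq> z \<Longrightarrow> measure_pmf.expectation (K x) V \<le> V x - 1"
    and z: "z \<in> X"
  shows "(\<Sum>k<n. avoid_prob K z k z) \<le> 1 + measure_pmf.expectation (K z) V"
proof -
  have step: "(\<Sum>k<Suc n. avoid_prob K z k x) \<le> 1 + measure_pmf.expectation (K x) V"
    if x: "x \<in> X" and IH: "\<And>y. y \<in> X \<Longrightarrow> y \<noteq> z \<Longrightarrow> (\<Sum>k<n. avoid_prob K z k y) \<le> V y" for x n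
  proof -
    have "(\<Sum>k<Suc n. avoid_prob K z k x)
        = 1 + measure_pmf.expectation (K x) (\<lambda>y. \<Sum>k<n. if y = z then 0 else avoid_prob K z k y)"
      by (subst sum.lessThan_Suc_shift) (simp add: Bochner_Integration.integral_sum)
    also have "\<dots> \<le> 1 + measure_pmf.expectation (K x) V"
    proof (intro add_left_mono expectation_mono x)
      fix y assume "y \<in> X"
      then show "(\<Sum>k<n. if y = z then 0 else avoid_prob K z k y) \<le> V y"
        using IH[of y] V[of y] by (cases "y = z") simp_all
    qed
    finally show ?thesis .
  qed
  have off: "y \<in> X \<Longrightarrow> y \<noteq> z \<Longrightarrow> (\<Sum>k<n. avoid_prob K z k y) \<le> V y" for n y
  proof (induction n arbitrary: y)
    case 0
    then show ?case using V by simp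
  next
    case (Suc n)
    show ?case using step[OF Suc.prems(1) Suc.IH] drift[OF Suc.prems] by linarith
  qed
  have "(\<Sum>k<n. avoid_prob K z k z) \<le> (\<Sum>k<Suc n. avoid_prob K z k z)"
    by (simp add: avoid_prob_nonneg)
  also have "\<dots> \<le> 1 + measure_pmf.expectation (K z) V" by (rule step[OF z off])
  finally show ?thesis .
qed

lemma expectation_less_1:
  fixes h :: "'a \<Rightarrow> real"
  assumes x: "x \<in> X" and y: "y \<in> set_pmf (K x)" "h y < 1" and le: "\<And>u. h u \<le> 1"
  shows "measure_pmf.expectation (K x) h < 1"
proof -
  have "measure_pmf.expectation (K x) h = (\<Sum>u\<in>set_pmf (K x). pmf (K x) u * h u)"
    using integral_measure_pmf[OF finite_branching[OF x], of "K x" h] by simp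
  also have "\<dots> < (\<Sum>u\<in>set_pmf (K x). pmf (K x) u * 1)"
  proof (rule sum_strict_mono_ex1[OF finite_branching[OF x]])
    show "\<forall>u\<in>set_pmf (K x). pmf (K x) u * h u \<le> pmf (K x) u * 1"
      using le by (auto intro: mult_left_mono simp del: mult_1_right)
    show "\<exists>u\<in>set_pmf (K x). pmf (K x) u * h u < pmf (K x) u * 1"
      using y by (intro bexI[of _ y] mult_strict_left_mono) (auto intro: pmf_positive)
  qed
  also have "\<dots> = 1" using sum_pmf_eq_1[OF finite_branching[OF x], of "K x"] by simp
  finally show ?thesis .
qed

lemma reachable_imp_avoid_prob_less_1:
  assumes "(x, z) \<in> {(a, b). a \<in> X \<and> b \<in> set_pmf (K a)}\<^sup>+"
  shows "\<exists>n. avoid_prob K z n x < 1"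
  using assms
proof (induction rule: converse_trancl_induct)
  case (base x)
  then have "avoid_prob K z 1 x < 1"
    unfolding One_nat_def avoid_prob.simps(2)
    by (intro expectation_less_1[of x z]) auto
  then show ?case ..
next
  case (step x y)
  then obtain n where n: "avoid_prob K z n y < 1" by blast
  have "avoid_prob K z (Suc n) x < 1"
    unfolding avoid_prob.simps(2)
    using step n by (intro expectation_less_1[of x y]) (auto simp: avoid_prob_le_1)
  then show ?case ..
qed

text \<open>The bounded function \<open>g\<close>, the mean number of steps before \<open>z\<close> is hit truncated at \<open>N\<close>, decreases on
  average off \<open>z\<close> by the probability of hitting \<open>z\<close> within \<open>N\<close> steps. That is at least some \<open>\<delta> > 0\<close> on
  the finite exceptional set \<open>F\<close>, once \<open>N\<close> is large. Adding a large multiple of \<open>g\<close> to \<open>L\<close> thus makes up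
  for the possible growth of \<open>L\<close> on \<open>F\<close>, and leaves \<open>z\<close> as the only exceptional state.\<close>

theorem foster:
  fixes L :: "'a \<Rightarrow> real"
  assumes L: "\<And>x. x \<in> X \<Longrightarrow> 0 \<le> L x"
    and F: "finite F" "F \<subseteq> X"
    and drift: "\<And>x. x \<in> X \<Longrightarrow>
      measure_pmf.expectation (K x) L \<le> L x - 1 + (if x \<in> F then A else 0)"
    and z: "z \<in> X"
    and reach: "\<And>x. x \<in> X \<Longrightarrow> (x, z) \<in> {(a, b). a \<in> X \<and> b \<in> set_pmf (K a)}\<^sup>+"
  shows "positive_recurrent_state K z"
proof -
  obtain m where m: "\<And>x. x \<in> X \<Longrightarrow> avoid_prob K z (m x) x < 1"
    using reachable_imp_avoid_prob_less_1[OF reach] by metis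
  define N where "N = Max (insert 0 (m ` F))"
  have N: "avoid_prob K z N x < 1" if "x \<in> F" for x
  proof -
    have "m x \<le> N" unfolding N_def using that F by (intro Max_ge) auto
    then show ?thesis using m[of x] avoid_prob_antimono[of "m x" N K z x] that F by force
  qed
  define \<delta> where "\<delta> = Min (insert 1 ((\<lambda>x. 1 - avoid_prob K z N x) ` F))"
  have \<delta>: "\<delta> > 0" unfolding \<delta>_def using F N by (subst Min_gr_iff) auto
  have \<delta>_le: "\<delta> \<le> 1 - avoid_prob K z N x" if "x \<in> F" for x
    unfolding \<delta>_def using that F by (intro Min_le) auto
  define g where "g y = (\<Sum>k<N. if y = z then 0 else avoid_prob K z k y)" for y
  define c where "c = max A 0 / \<delta>"
  define V where "V y = L y + c * g y" for y
  have c: "c \<ge> 0" using \<delta> by (simp add: c_def)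
  have g: "g y \<ge> 0" for y by (auto simp: g_def intro!: sum_nonneg avoid_prob_nonneg)
  have gdrift: "measure_pmf.expectation (K x) g = g x - (1 - avoid_prob K z N x)"
    if "x \<in> X" "x \<noteq> z" for x
  proof -
    have "measure_pmf.expectation (K x) g = (\<Sum>k<N. avoid_prob K z (Suc k) x)"
      unfolding g_def by (simp add: Bochner_Integration.integral_sum)
    also have "\<dots> = (\<Sum>k<Suc N. avoid_prob K z k x) - 1"
      by (subst sum.lessThan_Suc_shift) simp
    finally show ?thesis using that by (simp add: g_def)
  qed
  have Vdrift: "measure_pmf.expectation (K x) V \<le> V x - 1" if x: "x \<in> X" "x \<noteq> z" for x
  proof -
    have "measure_pmf.expectation (K x) V
        = measure_pmf.expectation (K x) L + c * measure_pmf.expectation (K x) g"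
      unfolding V_def using x integrable_step by (subst Bochner_Integration.integral_add) auto
    also have "\<dots> \<le> L x - 1 + (if x \<in> F then A else 0) + c * (g x - (1 - avoid_prob K z N x))"
      using drift[OF x(1)] gdrift[OF x] by simp
    also have "\<dots> \<le> V x - 1"
    proof (cases "x \<in> F")
      case True
      have "A \<le> c * \<delta>" using \<delta> by (simp add: c_def)
      also have "\<dots> \<le> c * (1 - avoid_prob K z N x)"
        using \<delta>_le[OF True] c by (intro mult_left_mono)
      finally show ?thesis using True by (simp add: V_def algebra_simps)
    next
      case False
      have "0 \<le> c * (1 - avoid_prob K z N x)" using c avoid_prob_le_1[of K z N x] by simp
      then show ?thesis using False by (simp add: V_def algebra_simps)
    qed
    finally show ?thesis .
  qed
  have "0 \<le> V y" if "y \<in> X" for y using L[OF that] c g by (simp add: V_def)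
  from positive_recurrent_state_if_bounded[OF expected_return_time_le[OF this Vdrift z]]
  show ?thesis by simp
qed

section \<open>Submartingales along a positive recurrent chain\<close>

text \<open>This is optional stopping at the return time \<open>T\<close> to \<open>z\<close>. As \<open>D\<close> grows by at most \<open>1\<close> per step, the
  contribution of paths with \<open>T > n\<close> to the mean of \<open>D - D z\<close> at time \<open>min n T\<close> is at most
  \<open>n * P(T > n)\<close>, which vanishes in the limit; paths with \<open>T \<le> n\<close> contribute nothing, because they
  are stopped at \<open>z\<close>. So the mean gain in the first step, which later steps cannot undo, is at most \<open>0\<close>.\<close>

lemma submartingale_harmonic:
  fixes D :: "'a \<Rightarrow> real"
  assumes D: "\<And>x. x \<in> X \<Longrightarrow> D x \<le> measure_pmf.expectation (K x) D"
    and incr: "\<And>x y. x \<in> X \<Longrightarrow> y \<in> set_pmf (K x) \<Longrightarrow> \<bar>D y - D x\<bar> \<le> 1"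
    and z: "z \<in> X" "positive_recurrent_state K z"
  shows "measure_pmf.expectation (K z) D = D z"
proof (rule antisym)
  \<comment> \<open>The mean of \<open>D - D z\<close> at time \<open>n\<close> on the event that \<open>z\<close> is not visited at times \<open>1, \<dots>, n\<close>.\<close>
  define e :: "nat \<Rightarrow> 'a \<Rightarrow> real" where
    "e = rec_nat (\<lambda>x. D x - D z)
          (\<lambda>n r x. measure_pmf.expectation (K x) (\<lambda>y. if y = z then 0 else r y))"
  have e_0: "e 0 x = D x - D z" for x by (simp add: e_def)
  have e_Suc: "e (Suc n) x = measure_pmf.expectation (K x) (\<lambda>y. if y = z then 0 else e n y)" for n x
    unfolding e_def by simp
  have lower1: "measure_pmf.expectation (K x) D - D z \<le> e (Suc n) x"
    if "x \<in> X" and IH: "\<And>y. y \<in> X \<Longrightarrow> D y - D z \<le> e n y" for x n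
  proof -
    have "measure_pmf.expectation (K x) D - D z = measure_pmf.expectation (K x) (\<lambda>y. D y - D z)"
      using that integrable_step by (subst Bochner_Integration.integral_diff) auto
    also have "\<dots> \<le> e (Suc n) x"
      unfolding e_Suc by (rule expectation_mono) (use that in auto)
    finally show ?thesis .
  qed
  have lower: "x \<in> X \<Longrightarrow> D x - D z \<le> e n x" for n x
  proof (induction n arbitrary: x)
    case (Suc n)
    then show ?case using lower1[OF Suc.prems Suc.IH] D[OF Suc.prems] by linarith
  qed (simp add: e_0)
  have upper: "x \<in> X \<Longrightarrow> e n x \<le> (\<bar>D x - D z\<bar> + n) * avoid_prob K z n x" for n x
  proof (induction n arbitrary: x)
    case (Suc n)
    have "e (Suc n) x \<le> measure_pmf.expectation (K x)
        (\<lambda>y. (\<bar>D x - D z\<bar> + Suc n) * (if y = z then 0 else avoid_prob K z n y))"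
      unfolding e_Suc
    proof (rule expectation_mono[OF Suc.prems])
      fix y assume y: "y \<in> X" "y \<in> set_pmf (K x)"
      have "e n y \<le> (\<bar>D y - D z\<bar> + n) * avoid_prob K z n y" using Suc.IH[OF y(1)] .
      also have "\<dots> \<le> (\<bar>D x - D z\<bar> + Suc n) * avoid_prob K z n y"
        using incr[OF Suc.prems y(2)] by (intro mult_right_mono avoid_prob_nonneg) auto
      finally show "(if y = z then 0 else e n y)
          \<le> (\<bar>D x - D z\<bar> + Suc n) * (if y = z then 0 else avoid_prob K z n y)" by simp
    qed
    then show ?case by simp
  qed (simp add: e_0)
  have "\<forall>\<^sub>F n in sequentially. measure_pmf.expectation (K z) D - D z \<le> real n * avoid_prob K z n z"
    unfolding eventually_sequentially
  proof (intro exI allI impI)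
    fix n :: nat assume "1 \<le> n"
    then obtain m where n: "n = Suc m" by (cases n) auto
    show "measure_pmf.expectation (K z) D - D z \<le> real n * avoid_prob K z n z"
      using lower1[OF z(1) lower, of m] upper[OF z(1), of n] by (simp add: n del: avoid_prob.simps)
  qed
  then have "measure_pmf.expectation (K z) D - D z \<le> 0"
    by (intro tendsto_lowerbound[OF positive_recurrent_state_imp_tail[OF z(2)]]) auto
  then show "measure_pmf.expectation (K z) D \<le> D z" by simp
qed (rule D[OF z(1)])

end

section \<open>Multigraphs\<close>

lemma adj_sym: "adj G u v \<longleftrightarrow> adj G v u"
  by (simp add: adj_def insert_commute)

lemma adj_nodes:
  assumes "multigraph G" "adj G u v"
  shows "u \<in> nodes G" "v \<in> nodes G"
  using assms unfolding multigraph_def adj_def by auto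

lemma edge_cases:
  assumes "multigraph G" "S \<in> edges G"
  obtains u v where "S = {u, v}" "adj G u v"
proof -
  from assms consider "card S = 1" | "card S = 2" unfolding multigraph_def by blast
  then have "\<exists>u v. S = {u, v}"
    by cases (auto simp: card_1_singleton_iff card_2_iff)
  with assms(2) that show ?thesis unfolding adj_def by blast
qed

lemma finite_edges:
  assumes "multigraph G" shows "finite (edges G)"
proof (rule finite_subset)
  show "edges G \<subseteq> Pow (nodes G)" using assms unfolding multigraph_def by blast
  show "finite (Pow (nodes G))" using assms unfolding multigraph_def by blast
qed

lemma independent_setsI:
  assumes "multigraph G" "I \<noteq> {}" "I \<subseteq> nodes G"
    and "\<And>u v. u \<in> I \<Longrightarrow> v \<in> I \<Longrightarrow> \<not> adj G u v"
  shows "I \<in> independent_sets G"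
  unfolding independent_sets_def using assms by (auto elim!: edge_cases)

lemma independent_sets_not_adj:
  "I \<in> independent_sets G \<Longrightarrow> u \<in> I \<Longrightarrow> v \<in> I \<Longrightarrow> \<not> adj G u v"
  unfolding independent_sets_def adj_def by auto

text \<open>The only connected multigraph with an isolated node is a single node without self-loop, which is
  bipartite with an empty second part.\<close>

lemma exists_neighbor:
  assumes G: "multigraph G" "connected_multigraph G" "\<not> bipartite_graph G" and u: "u \<in> nodes G"
  shows "\<exists>v. adj G u v"
proof (rule ccontr)
  assume isolated: "\<nexists>v. adj G u v"
  have "nodes G = {u}"
  proof -
    have "v = u" if "v \<in> nodes G" for v
    proof -
      have "(u, v) \<in> {(a, b). adj G a b}\<^sup>*"
        using G(2) u that unfolding connected_multigraph_def by blast
      then show ?thesis by (rule converse_rtranclE) (use isolated in auto)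
    qed
    with u show ?thesis by blast
  qed
  moreover have "edges G = {}"
  proof -
    have False if S: "S \<in> edges G" for S
    proof -
      obtain a b where "adj G a b" using edge_cases[OF G(1) S] by blast
      with adj_nodes[OF G(1) this] isolated \<open>nodes G = {u}\<close> show False by auto
    qed
    then show ?thesis by blast
  qed
  ultimately have "bipartite_graph G"
    unfolding bipartite_graph_def loop_nodes_def adj_def
    by (intro conjI exI[of _ "{u}"] exI[of _ "{}"]) simp_all
  with G(3) show False ..
qed

text \<open>Otherwise every edge would join \<open>I\<close> to its neighbourhood, which by connectedness covers all other
  nodes: the two sets would be the parts of a bipartite graph.\<close>

lemma exists_edge_escaping_independent_set:
  assumes G: "multigraph G" "connected_multigraph G" "\<not> bipartite_graph G"
    and I: "I \<in> independent_sets G"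
  shows "\<exists>j k. j \<in> nbhd G I \<and> k \<notin> I \<and> adj G j k"
proof (rule ccontr)
  assume "\<nexists>j k. j \<in> nbhd G I \<and> k \<notin> I \<and> adj G j k"
  then have ret: "k \<in> I" if "j \<in> nbhd G I" "adj G j k" for j k using that by blast
  have forw: "k \<in> nbhd G I" if "j \<in> I" "adj G j k" for j k
    using that adj_nodes[OF G(1)] unfolding nbhd_def by blast
  have disj: "I \<inter> nbhd G I = {}"
    using independent_sets_not_adj[OF I] unfolding nbhd_def by blast
  obtain i where i: "i \<in> I" "i \<in> nodes G" using I unfolding independent_sets_def by blast
  have cover: "I \<union> nbhd G I = nodes G"
  proof
    show "I \<union> nbhd G I \<subseteq> nodes G" using I unfolding independent_sets_def nbhd_def by blast
    show "nodes G \<subseteq> I \<union> nbhd G I"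
    proof
      fix v assume "v \<in> nodes G"
      then have "(i, v) \<in> {(a, b). adj G a b}\<^sup>*"
        using G(2) i unfolding connected_multigraph_def by blast
      then show "v \<in> I \<union> nbhd G I"
        by (induction rule: rtrancl_induct) (use i ret forw in auto)
    qed
  qed
  have edge: "\<exists>a\<in>I. \<exists>b\<in>nbhd G I. S = {a, b}" if "S \<in> edges G" for S
  proof -
    obtain u v where uv: "S = {u, v}" "adj G u v" using edge_cases[OF G(1) \<open>S \<in> edges G\<close>] .
    consider "u \<in> I" | "u \<in> nbhd G I" using adj_nodes[OF G(1) uv(2)] cover by blast
    then show ?thesis
    proof cases
      case 1
      with uv forw show ?thesis by blast
    next
      case 2
      with uv ret have "v \<in> I" "S = {v, u}" by auto
      with 2 show ?thesis by blast
    qed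
  qed
  have "loop_nodes G = {}"
    unfolding loop_nodes_def using cover disj ret forw by blast
  then have "bipartite_graph G"
    unfolding bipartite_graph_def
    by (intro conjI exI[of _ I] exI[of _ "nbhd G I"] ballI cover disj edge)
  with G(3) show False ..
qed

section \<open>Buffers\<close>

lemma count_list_remove_nth:
  assumes "k < length b"
  shows "count_list b i = count_list (take k b @ drop (Suc k) b) i + (if i = b ! k then 1 else 0)"
  by (subst (1) id_take_nth_drop[OF assms]) auto

lemma buffers_mono:
  assumes b: "b \<in> buffers G" and le: "\<And>i. count_list b' i \<le> count_list b i"
  shows "b' \<in> buffers G"
proof -
  have "i \<in> set b" if "i \<in> set b'" for i
    using le[of i] that by (metis count_list_0_iff le_zero_eq)
  then have "set b' \<subseteq> nodes G" using b unfolding buffers_def by blast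
  moreover have "count_list b' i * count_list b' j = 0" if "i \<noteq> j" "adj G i j" for i j
  proof -
    have "count_list b i * count_list b j = 0" using b that unfolding buffers_def by blast
    with le[of i] le[of j] show ?thesis by (metis le_zero_eq mult_is_0)
  qed
  moreover have "count_list b' i \<le> 1" if "i \<in> loop_nodes G" for i
  proof -
    have "count_list b i \<le> 1" using b that unfolding buffers_def by blast
    with le[of i] show ?thesis by linarith
  qed
  ultimately show ?thesis
    unfolding buffers_def by (intro CollectI conjI allI impI ballI) simp_all
qed

lemma buffers_adjE:
  assumes b: "b \<in> buffers G" and "adj G u v" "u \<noteq> v" "u \<in> set b"
  shows "v \<notin> set b"
  using assms unfolding buffers_def by (auto simp: count_list_0_iff)

lemma buffers_append:
  assumes G: "multigraph G" and b: "b \<in> buffers G" and v: "v \<in> nodes G"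
    and no: "\<And>u. u \<in> set b \<Longrightarrow> \<not> adj G v u"
  shows "b @ [v] \<in> buffers G"
proof -
  have z: "count_list b u = 0" if "adj G v u" for u using no that by (auto simp: count_list_0_iff)
  have z': "count_list b u = 0" if "adj G u v" for u using z that by (simp add: adj_sym)
  show ?thesis
    using b v z z' unfolding buffers_def loop_nodes_def by auto
qed

lemma buffers_remove_nth:
  assumes b: "b \<in> buffers G" and k: "k < length b"
  shows "take k b @ drop (Suc k) b \<in> buffers G"
proof (rule buffers_mono[OF b])
  show "count_list (take k b @ drop (Suc k) b) i \<le> count_list b i" for i
    using count_list_remove_nth[OF k, of i] by linarith
qed

text \<open>Makes the exceptional set of the quadratic Lyapunov function finite.\<close>

lemma finite_bounded_buffers:
  assumes "multigraph G"
  shows "finite {b \<in> buffers G. \<forall>v\<in>nodes G. count_list b v \<le> B}"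
proof (rule finite_subset)
  show "{b \<in> buffers G. \<forall>v\<in>nodes G. count_list b v \<le> B}
      \<subseteq> {b. set b \<subseteq> nodes G \<and> length b \<le> card (nodes G) * B}"
  proof safe
    fix b assume b: "b \<in> buffers G" "\<forall>v\<in>nodes G. count_list b v \<le> B"
    have "finite (nodes G)" using assms unfolding multigraph_def by blast
    moreover have "set b \<subseteq> nodes G" using b unfolding buffers_def by blast
    ultimately have "length b = sum (count_list b) (nodes G)" by (rule sum_count_set[rotated, symmetric])
    also have "\<dots> \<le> card (nodes G) * B" 
      using b(2) sum_bounded_above[of "nodes G" "count_list b" B] by simp
    finally show "length b \<le> card (nodes G) * B" .
  qed (auto simp: buffers_def)
  show "finite {b. set b \<subseteq> nodes G \<and> length b \<le> card (nodes G) * B}"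
    using assms unfolding multigraph_def by (intro finite_lists_length_le) auto
qed

section \<open>The buffer process of a matching model\<close>

text \<open>The policy is arbitrary, up to the requirement that it matches an incoming item with a stored item
  of a compatible class, with finitely many possible choices.\<close>

locale matching_model =
  fixes G :: "'v multigraph" and \<Phi> :: "'v policy" and \<mu> :: "'v pmf"
  assumes multigraph: "multigraph G"
    and full_support: "set_pmf \<mu> = nodes G"
    and finite_policy: "\<lbrakk>b \<in> buffers G; v \<in> nodes G; set b \<inter> nbhd G {v} \<noteq> {}\<rbrakk>
      \<Longrightarrow> finite (set_pmf (\<Phi> b v))"
    and policy_matches: "\<lbrakk>b \<in> buffers G; v \<in> nodes G; set b \<inter> nbhd G {v} \<noteq> {}; k \<in> set_pmf (\<Phi> b v)\<rbrakk>
      \<Longrightarrow> k < length b \<and> adj G v (b ! k)"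
begin

abbreviation "buf_kernel \<equiv> matching_kernel G \<Phi> \<mu>"

definition arrival :: "'v list \<Rightarrow> 'v \<Rightarrow> 'v list pmf" where
  "arrival b v = (if set b \<inter> nbhd G {v} \<noteq> {}
     then map_pmf (\<lambda>k. take k b @ drop (Suc k) b) (\<Phi> b v)
     else return_pmf (b @ [v]))"

lemma kernel_arrival: "buf_kernel b = bind_pmf \<mu> (arrival b)"
  unfolding matching_kernel_def arrival_def ..

lemma finite_nodes: "finite (nodes G)"
  using multigraph unfolding multigraph_def by blast

lemma set_inter_nbhd_iff:
  "set b \<inter> nbhd G {v} \<noteq> {} \<longleftrightarrow> (\<exists>u\<in>set b. adj G v u)"
  using adj_nodes[OF multigraph] unfolding nbhd_def by blast

lemma arrival_cases [consumes 3, case_names stored matched]: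
  assumes "b \<in> buffers G" "v \<in> nodes G" "y \<in> set_pmf (arrival b v)"
  obtains "\<And>u. u \<in> set b \<Longrightarrow> \<not> adj G v u" "y = b @ [v]"
  | k where "k < length b" "k \<in> set_pmf (\<Phi> b v)" "adj G v (b ! k)"
      "y = take k b @ drop (Suc k) b" "set b \<inter> nbhd G {v} \<noteq> {}"
proof (cases "set b \<inter> nbhd G {v} \<noteq> {}")
  case True
  with assms(3) obtain k where "k \<in> set_pmf (\<Phi> b v)" "y = take k b @ drop (Suc k) b"
    unfolding arrival_def by auto
  with policy_matches[OF assms(1,2) True] True that(2) show ?thesis by blast
next
  case False
  with assms(3) have "y = b @ [v]" unfolding arrival_def by auto
  with False that(1) show ?thesis unfolding set_inter_nbhd_iff by blast
qed

lemma arrival_buffers: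
  assumes "b \<in> buffers G" "v \<in> nodes G" "y \<in> set_pmf (arrival b v)"
  shows "y \<in> buffers G"
  using assms
proof (cases rule: arrival_cases)
  case stored
  then show ?thesis using buffers_append[OF multigraph assms(1,2)] by simp
next
  case (matched k)
  then show ?thesis using buffers_remove_nth[OF assms(1)] by simp
qed

lemma finite_arrival: "b \<in> buffers G \<Longrightarrow> v \<in> nodes G \<Longrightarrow> finite (set_pmf (arrival b v))"
  using finite_policy[of b v] unfolding arrival_def by simp

lemma set_kernel: "set_pmf (buf_kernel b) = (\<Union>v\<in>nodes G. set_pmf (arrival b v))"
  by (simp add: kernel_arrival full_support)

sublocale finitely_branching_chain buf_kernel "buffers G"
  by standard (auto simp: set_kernel arrival_buffers finite_arrival finite_nodes)

lemma expectation_kernel: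
  "b \<in> buffers G \<Longrightarrow> measure_pmf.expectation (buf_kernel b) h
     = (\<Sum>v\<in>nodes G. pmf \<mu> v * measure_pmf.expectation (arrival b v) (h :: _ \<Rightarrow> real))"
  unfolding kernel_arrival
  by (subst pmf_expectation_bind[OF finite_nodes]) (auto simp: full_support finite_arrival)

lemma expectation_kernel_le:
  fixes h :: "'v list \<Rightarrow> real"
  assumes "b \<in> buffers G" and "\<And>v y. v \<in> nodes G \<Longrightarrow> y \<in> set_pmf (arrival b v) \<Longrightarrow> h y \<le> c v"
  shows "measure_pmf.expectation (buf_kernel b) h \<le> (\<Sum>v\<in>nodes G. pmf \<mu> v * c v)"
  unfolding expectation_kernel[OF assms(1)]
  by (intro sum_mono mult_left_mono measure_pmf.integral_le_const integrable_measure_pmf_finite)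
     (use assms in \<open>auto simp: finite_arrival AE_measure_pmf_iff\<close>)

lemma expectation_kernel_ge:
  fixes h :: "'v list \<Rightarrow> real"
  assumes "b \<in> buffers G" and "\<And>v y. v \<in> nodes G \<Longrightarrow> y \<in> set_pmf (arrival b v) \<Longrightarrow> c v \<le> h y"
  shows "(\<Sum>v\<in>nodes G. pmf \<mu> v * c v) \<le> measure_pmf.expectation (buf_kernel b) h"
  unfolding expectation_kernel[OF assms(1)]
  by (intro sum_mono mult_left_mono measure_pmf.integral_ge_const integrable_measure_pmf_finite)
     (use assms in \<open>auto simp: finite_arrival AE_measure_pmf_iff\<close>)

lemma sum_pmf_nodes: "(\<Sum>v\<in>nodes G. pmf \<mu> v) = 1"
  by (rule sum_pmf_eq_1[OF finite_nodes]) (simp add: full_support)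

lemma prob_eq_sum: "S \<subseteq> nodes G \<Longrightarrow> measure_pmf.prob \<mu> S = (\<Sum>v\<in>S. pmf \<mu> v)"
  by (intro measure_measure_pmf_finite finite_subset[OF _ finite_nodes])

subsection \<open>Irreducibility\<close>

abbreviation "moves \<equiv> {(a, b). a \<in> buffers G \<and> b \<in> set_pmf (buf_kernel a)}"

text \<open>As long as the buffer is not empty, the arrival of a neighbour of its oldest item
  shortens it, whichever item the policy picks.\<close>

lemma reach_empty:
  assumes nbr: "\<And>u. u \<in> nodes G \<Longrightarrow> \<exists>v. adj G u v"
  shows "b \<in> buffers G \<Longrightarrow> (b, []) \<in> moves\<^sup>*"
proof (induction "length b" arbitrary: b rule: less_induct)
  case less
  show ?case
  proof (cases b)
    case (Cons i b')
    then have "i \<in> nodes G" using less.prems unfolding buffers_def by auto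
    with nbr obtain v where v: "adj G i v" by blast
    then have vG: "v \<in> nodes G" using adj_nodes[OF multigraph] by blast
    obtain y where y: "y \<in> set_pmf (arrival b v)" using set_pmf_not_empty[of "arrival b v"] by blast
    from less.prems vG y have "length y < length b"
    proof (cases rule: arrival_cases)
      case stored
      with v Cons show ?thesis by (simp add: adj_sym)
    qed simp
    moreover have yb: "y \<in> buffers G" by (rule arrival_buffers[OF less.prems vG y])
    ultimately have "(y, []) \<in> moves\<^sup>*" by (rule less.hyps)
    moreover have "(b, y) \<in> moves" using less.prems vG y by (auto simp: set_kernel)
    ultimately show ?thesis by (rule converse_rtrancl_into_rtrancl[rotated])
  qed simp
qed

text \<open>No two items of a buffer can be matched with each other, so letting them arrive in order
  stores all of them.\<close>

lemma reach_from_empty: "b \<in> buffers G \<Longrightarrow> ([], b) \<in> moves\<^sup>*"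
proof (induction b rule: rev_induct)
  case (snoc v b)
  have b: "b \<in> buffers G" using buffers_remove_nth[OF snoc.prems, of "length b"] by simp
  have v: "v \<in> nodes G" using snoc.prems unfolding buffers_def by auto
  have no: "\<not> adj G v u" if u: "u \<in> set b" for u
  proof
    assume adj: "adj G v u"
    show False
    proof (cases "u = v")
      case True
      then have "count_list (b @ [v]) v \<le> 1"
        using snoc.prems adj v unfolding buffers_def loop_nodes_def by blast
      with u True show False by (simp add: count_list_0_iff)
    next
      case False
      then show False using buffers_adjE[OF snoc.prems adj] u by auto
    qed
  qed
  have "arrival b v = return_pmf (b @ [v])"
    using no unfolding arrival_def set_inter_nbhd_iff by auto
  then have "b @ [v] \<in> set_pmf (buf_kernel b)" using v by (force simp: set_kernel)
  with b have "(b, b @ [v]) \<in> moves" by simp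
  with snoc.IH[OF b] show ?case by (rule rtrancl_into_rtrancl)
qed simp

lemma irreducible:
  assumes nbr: "\<And>u. u \<in> nodes G \<Longrightarrow> \<exists>v. adj G u v" and "a \<in> buffers G" "b \<in> buffers G"
  shows "(a, b) \<in> moves\<^sup>+"
proof -
  obtain y where y: "y \<in> set_pmf (buf_kernel a)" using set_pmf_not_empty[of "buf_kernel a"] by blast
  then have "(a, y) \<in> moves" using assms by simp
  moreover have "(y, b) \<in> moves\<^sup>*"
    using reach_empty[OF nbr, of y] reach_from_empty[of b] y assms closed[of a] by force
  ultimately show ?thesis by (rule rtrancl_into_trancl2)
qed

section \<open>Necessity of the condition for every policy\<close>

lemma stable_imp_Ncond:
  assumes G: "connected_multigraph G" "\<not> bipartite_graph G"
    and stable: "positive_recurrent_on (buffers G) buf_kernel"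
  shows "\<mu> \<in> Ncond G"
proof -
  have "measure_pmf.prob \<mu> I < measure_pmf.prob \<mu> (nbhd G I)" if I: "I \<in> independent_sets G" for I
  proof (rule ccontr)
    assume "\<not> ?thesis"
    then have heavy: "measure_pmf.prob \<mu> (nbhd G I) \<le> measure_pmf.prob \<mu> I" by simp
    have sub: "I \<subseteq> nodes G" "nbhd G I \<subseteq> nodes G"
      using I unfolding independent_sets_def nbhd_def by auto
    have disj: "v \<notin> nbhd G I" if "v \<in> I" for v
      using independent_sets_not_adj[OF I] that unfolding nbhd_def by blast
    \<comment> \<open>\<open>D\<close> is additive over the items of the buffer, with weight \<open>s\<close>. Adjacent classes have weights of
      nonpositive sum, so removing a neighbour of \<open>v\<close> changes \<open>D\<close> by at least \<open>s v\<close>.\<close>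
    define s :: "'v \<Rightarrow> real" where "s v = indicator I v - indicator (nbhd G I) v" for v
    define D where "D b = sum_list (map s b)" for b
    have D_append: "D (b @ [v]) = D b + s v" for b v by (simp add: D_def)
    have D_remove: "D (take k b @ drop (Suc k) b) = D b - s (b ! k)" if "k < length b" for k b
    proof -
      have "D b = D (take k b @ b ! k # drop (Suc k) b)" using id_take_nth_drop[OF that] by simp
      then show ?thesis by (simp add: D_def)
    qed
    have s_abs: "\<bar>s v\<bar> \<le> 1" for v by (auto simp: s_def indicator_def)
    have s_adj: "s u + s v \<le> 0" if "adj G u v" for u v
    proof -
      have "u \<in> I \<Longrightarrow> v \<in> nbhd G I" "v \<in> I \<Longrightarrow> u \<in> nbhd G I"
        using that adj_nodes[OF multigraph that] unfolding nbhd_def by (auto simp: adj_sym)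
      then show ?thesis using disj[of u] disj[of v] by (auto simp: s_def indicator_def)
    qed
    have "(\<Sum>v\<in>nodes G. pmf \<mu> v * s v) = measure_pmf.prob \<mu> I - measure_pmf.prob \<mu> (nbhd G I)"
      using sub finite_nodes
      by (simp add: s_def prob_eq_sum right_diff_distrib sum_subtractf indicator_def
          if_distrib[of "(*) _"] sum.If_cases Int_absorb1 flip: of_bool_def cong: if_cong)
    with heavy have mean_s: "0 \<le> (\<Sum>v\<in>nodes G. pmf \<mu> v * s v)" by simp
    have step: "D b + s v \<le> D y \<and> \<bar>D y - D b\<bar> \<le> 1"
      if b: "b \<in> buffers G" and v: "v \<in> nodes G" and y: "y \<in> set_pmf (arrival b v)" for b v y
      using b v y
    proof (cases rule: arrival_cases)
      case stored
      then show ?thesis using s_abs[of v] by (simp add: D_append)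
    next
      case (matched k)
      then show ?thesis using s_abs[of "b ! k"] s_adj[of v "b ! k"] by (simp add: D_remove)
    qed
    have sub_D: "D b \<le> measure_pmf.expectation (buf_kernel b) D" if b: "b \<in> buffers G" for b
    proof -
      have "D b \<le> (\<Sum>v\<in>nodes G. pmf \<mu> v * (D b + s v))"
        using mean_s by (simp add: ring_distribs sum.distrib sum_pmf_nodes flip: sum_distrib_right)
      also have "\<dots> \<le> measure_pmf.expectation (buf_kernel b) D"
        by (intro expectation_kernel_ge b) (use step[OF b] in blast)
      finally show ?thesis .
    qed
    obtain j k where jk: "j \<in> nbhd G I" "k \<notin> I" "adj G j k"
      using exists_edge_escaping_independent_set[OF multigraph G I] by blast
    have nodes: "j \<in> nodes G" "k \<in> nodes G" using adj_nodes[OF multigraph jk(3)] by auto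
    have j: "[j] \<in> buffers G" using nodes by (auto simp: buffers_def)
    have s_j: "s j = - 1" using jk(1) disj[of j] by (auto simp: s_def indicator_def)
    have s_k: "s k \<le> 0" using jk(2) by (auto simp: s_def indicator_def)
    \<comment> \<open>In the buffer \<open>[j]\<close> an arrival of class \<open>k\<close> empties the buffer, so \<open>D\<close> gains \<open>1\<close>, whereas storing
      the item would gain \<open>s k \<le> 0\<close>.\<close>
    have "D [j] + pmf \<mu> k \<le> (\<Sum>v\<in>nodes G. pmf \<mu> v * (D [j] + s v + (if v = k then 1 else 0)))"
      using mean_s nodes finite_nodes
      by (simp add: ring_distribs sum.distrib sum_pmf_nodes if_distrib[of "(*) _"]
          flip: sum_distrib_right cong: if_cong)
    also have "\<dots> \<le> measure_pmf.expectation (buf_kernel [j]) D"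
    proof (intro expectation_kernel_ge j)
      fix v y assume v: "v \<in> nodes G" "y \<in> set_pmf (arrival [j] v)"
      show "D [j] + s v + (if v = k then 1 else 0) \<le> D y"
      proof (cases "v = k")
        case True
        from j v have "y = []"
          by (cases rule: arrival_cases) (use jk(3) True in \<open>auto simp: adj_sym\<close>)
        with True s_j s_k show ?thesis by (simp add: D_def)
      qed (use step[OF j v] in simp)
    qed
    finally have "D [j] < measure_pmf.expectation (buf_kernel [j]) D"
      using nodes by (simp add: full_support[symmetric] set_pmf_iff) (smt (verit) pmf_nonneg)
    moreover have "measure_pmf.expectation (buf_kernel [j]) D = D [j]"
    proof (rule submartingale_harmonic[OF sub_D _ j])
      show "\<bar>D y - D x\<bar> \<le> 1" if "x \<in> buffers G" "y \<in> set_pmf (buf_kernel x)" for x y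
        using that step by (auto simp: set_kernel)
      show "positive_recurrent_state buf_kernel [j]"
        using stable j unfolding positive_recurrent_on_def by blast
    qed
    ultimately show False by simp
  qed
  with full_support show ?thesis unfolding Ncond_def full_support_measures_def by blast
qed

end

section \<open>Independent level sets and the quadratic Lyapunov function\<close>

text \<open>The inserted \<open>0\<close> is the value at a node without neighbours.\<close>

definition heaviest_nbr :: "'v multigraph \<Rightarrow> ('v \<Rightarrow> nat) \<Rightarrow> 'v \<Rightarrow> nat" where
  "heaviest_nbr G y v = Max (insert 0 (y ` nbhd G {v}))"

lemma le_heaviest_nbr_iff:
  assumes "finite (nodes G)" "0 < t"
  shows "t \<le> heaviest_nbr G y v \<longleftrightarrow> (\<exists>u\<in>nbhd G {v}. t \<le> y u)"
proof -
  have "finite (nbhd G {v})" using assms(1) unfolding nbhd_def by simp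
  then show ?thesis
    unfolding heaviest_nbr_def using assms(2) by (subst Max_ge_iff) auto
qed

lemma layer_cake:
  fixes p :: "'a \<Rightarrow> real" and f :: "'a \<Rightarrow> nat"
  assumes "finite S" "\<And>v. v \<in> S \<Longrightarrow> f v \<le> M"
  shows "(\<Sum>v\<in>S. p v * real (f v)) = (\<Sum>t=1..M. \<Sum>v\<in>{v \<in> S. t \<le> f v}. p v)"
proof -
  have "real (f v) = (\<Sum>t=1..M. if t \<le> f v then 1 else 0)" if "v \<in> S" for v
  proof -
    have "{1..M} \<inter> {t. t \<le> f v} = {1..f v}" using assms(2)[OF that] by auto
    then show ?thesis by (simp add: sum.If_cases)
  qed
  then have "(\<Sum>v\<in>S. p v * real (f v)) = (\<Sum>v\<in>S. \<Sum>t=1..M. if t \<le> f v then p v else 0)"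
    by (intro sum.cong) (auto simp: sum_distrib_left if_distrib[of "(*) _"] cong: if_cong)
  also have "\<dots> = (\<Sum>t=1..M. \<Sum>v\<in>S. if t \<le> f v then p v else 0)" by (rule sum.swap)
  finally show ?thesis using assms(1) by (simp add: sum.inter_filter)
qed

lemma Ncond_gap:
  assumes "multigraph G" "\<mu> \<in> Ncond G"
  obtains \<epsilon> where "\<epsilon> > 0"
    "\<And>I. I \<in> independent_sets G \<Longrightarrow>
      measure_pmf.prob \<mu> I + \<epsilon> \<le> measure_pmf.prob \<mu> (nbhd G I)"
proof -
  define gaps where
    "gaps = (\<lambda>I. measure_pmf.prob \<mu> (nbhd G I) - measure_pmf.prob \<mu> I) ` independent_sets G"
  have "independent_sets G \<subseteq> Pow (nodes G)" unfolding independent_sets_def by blast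
  then have fin: "finite gaps"
    using assms(1) unfolding gaps_def multigraph_def by (metis finite_Pow_iff finite_imageI finite_subset)
  have "0 < Min (insert 1 gaps)"
    using assms(2) fin unfolding gaps_def Ncond_def by (subst Min_gr_iff) auto
  moreover have "Min (insert 1 gaps) \<le> measure_pmf.prob \<mu> (nbhd G I) - measure_pmf.prob \<mu> I"
    if "I \<in> independent_sets G" for I
    using that fin unfolding gaps_def by (intro Min_le) auto
  ultimately show ?thesis using that[of "Min (insert 1 gaps)"] by force
qed

context matching_model
begin

text \<open>The layer-cake formula turns both sides into sums over the levels \<open>t\<close> of the measures of the sets
  \<open>{v. t \<le> y v}\<close> and of their neighbourhoods. The hypothesis on \<open>y\<close> makes these level sets independent,
  so that each of the \<open>max y\<close> nonempty levels gains \<open>\<epsilon>\<close>.\<close>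

lemma Ncond_weighted:
  assumes gap: "\<And>I. I \<in> independent_sets G \<Longrightarrow>
      measure_pmf.prob \<mu> I + \<epsilon> \<le> measure_pmf.prob \<mu> (nbhd G I)"
    and indep: "\<And>u v. adj G u v \<Longrightarrow> y u = 0 \<or> y v = 0"
  shows "(\<Sum>v\<in>nodes G. pmf \<mu> v * real (y v)) + \<epsilon> * real (Max (insert 0 (y ` nodes G)))
    \<le> (\<Sum>v\<in>nodes G. pmf \<mu> v * real (heaviest_nbr G y v))"
proof -
  define M where "M = Max (insert 0 (y ` nodes G))"
  have y_le: "y v \<le> M" if "v \<in> nodes G" for v
    unfolding M_def using that finite_nodes by (intro Max_ge) auto
  have nbr_le: "heaviest_nbr G y v \<le> M" for v
    unfolding heaviest_nbr_def M_def nbhd_def using finite_nodes by (intro Max_mono) auto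
  have level: "(\<Sum>v\<in>{v \<in> nodes G. t \<le> y v}. pmf \<mu> v) + \<epsilon>
      \<le> (\<Sum>v\<in>{v \<in> nodes G. t \<le> heaviest_nbr G y v}. pmf \<mu> v)" if t: "t \<in> {1..M}" for t
  proof -
    let ?I = "{v \<in> nodes G. t \<le> y v}"
    have "\<exists>v\<in>nodes G. t \<le> y v"
      using t finite_nodes unfolding M_def by (auto simp: Max_ge_iff)
    then have "?I \<in> independent_sets G"
      using indep t by (intro independent_setsI multigraph) fastforce+
    from gap[OF this] have "(\<Sum>v\<in>?I. pmf \<mu> v) + \<epsilon> \<le> (\<Sum>v\<in>nbhd G ?I. pmf \<mu> v)"
      by (simp add: prob_eq_sum nbhd_def)
    also have "nbhd G ?I = {v \<in> nodes G. t \<le> heaviest_nbr G y v}"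
      using t by (auto simp: le_heaviest_nbr_iff[OF finite_nodes] nbhd_def adj_sym)
    finally show ?thesis .
  qed
  have "(\<Sum>v\<in>nodes G. pmf \<mu> v * real (y v)) + \<epsilon> * real M
      = (\<Sum>t=1..M. (\<Sum>v\<in>{v \<in> nodes G. t \<le> y v}. pmf \<mu> v) + \<epsilon>)"
    by (subst layer_cake[OF finite_nodes y_le]) (simp_all add: sum.distrib)
  also have "\<dots> \<le> (\<Sum>t=1..M. \<Sum>v\<in>{v \<in> nodes G. t \<le> heaviest_nbr G y v}. pmf \<mu> v)"
    by (rule sum_mono[OF level])
  also have "\<dots> = (\<Sum>v\<in>nodes G. pmf \<mu> v * real (heaviest_nbr G y v))"
    using layer_cake[OF finite_nodes nbr_le] by simp
  finally show ?thesis unfolding M_def .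
qed

text \<open>Stability holds for every policy that picks one of the longest neighbouring queues up to an additive
  constant.\<close>

lemma Ncond_imp_stable:
  assumes G: "connected_multigraph G" "\<not> bipartite_graph G"
    and \<mu>: "\<mu> \<in> Ncond G"
    and C: "0 \<le> C"
    and greedy: "\<And>b v k u. \<lbrakk>b \<in> buffers G; v \<in> nodes G; set b \<inter> nbhd G {v} \<noteq> {};
        k \<in> set_pmf (\<Phi> b v); adj G v u\<rbrakk>
      \<Longrightarrow> real (count_list b u) \<le> real (count_list b (b ! k)) + C"
  shows "positive_recurrent_on (buffers G) buf_kernel"
proof -
  obtain \<epsilon> where \<epsilon>: "\<epsilon> > 0" and gap: "\<And>I. I \<in> independent_sets G \<Longrightarrow>
      measure_pmf.prob \<mu> I + \<epsilon> \<le> measure_pmf.prob \<mu> (nbhd G I)"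
    using Ncond_gap[OF multigraph \<mu>] by blast
  define L where "L b = (\<Sum>i\<in>nodes G. (real (count_list b i))\<^sup>2)" for b
  \<comment> \<open>Queues at self-loops are left out, which makes the support of \<open>y b\<close> independent. This changes
    each queue length by at most \<open>1\<close>, and the constant in \<open>A\<close> absorbs the change.\<close>
  define y where "y b v = (if adj G v v then 0 else count_list b v)" for b v
  define M where "M b = Max (insert 0 (y b ` nodes G))" for b
  define A where "A = 3 + 2 * C"
  have L_append: "L (b @ [v]) = L b + 2 * real (count_list b v) + 1" if "v \<in> nodes G" for b v
  proof -
    have "L (b @ [v]) = (\<Sum>i\<in>nodes G. (real (count_list b i))\<^sup>2
        + (if i = v then 2 * real (count_list b v) + 1 else 0))"
      unfolding L_def by (intro sum.cong) (auto simp: power2_eq_square algebra_simps)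
    with that finite_nodes show ?thesis by (simp add: L_def sum.distrib)
  qed
  \<comment> \<open>\<open>L\<close> ignores the order of the items, so a removal is an insertion at the end read backwards.\<close>
  have L_remove: "L (take k b @ drop (Suc k) b) = L b - 2 * real (count_list b (b ! k)) + 1"
    if "k < length b" "b ! k \<in> nodes G" for k b
  proof -
    have "L b = L (take k b @ drop (Suc k) b @ [b ! k])"
      unfolding L_def using count_list_remove_nth[OF that(1)] by (intro sum.cong) auto
    also have "\<dots> = L (take k b @ drop (Suc k) b)
        + 2 * real (count_list (take k b @ drop (Suc k) b) (b ! k)) + 1"
      using L_append[OF that(2), of "take k b @ drop (Suc k) b"] by simp
    finally show ?thesis using count_list_remove_nth[OF that(1), of "b ! k"] by simp
  qed
  have loop_le: "count_list b v \<le> y b v + 1" if "b \<in> buffers G" "v \<in> nodes G" for b v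
    using that unfolding buffers_def loop_nodes_def y_def by auto
  have y_indep: "y b u = 0 \<or> y b v = 0" if "b \<in> buffers G" "adj G u v" for b u v
    using that buffers_adjE[OF that] unfolding y_def by (metis count_list_0_iff)
  have nbr_cases: "heaviest_nbr G (y b) v = 0 \<or>
      (\<exists>u. adj G v u \<and> heaviest_nbr G (y b) v = y b u \<and> 0 < y b u)" for b v
  proof -
    have "finite (nbhd G {v})" using finite_nodes unfolding nbhd_def by simp
    then have "heaviest_nbr G (y b) v \<in> insert 0 (y b ` nbhd G {v})"
      unfolding heaviest_nbr_def by (intro Max_in) auto
    then show ?thesis by (auto simp: nbhd_def)
  qed
  have step: "L b' \<le> L b + A + 2 * real (y b v) - 2 * real (heaviest_nbr G (y b) v)"
    if b: "b \<in> buffers G" and v: "v \<in> nodes G" and b': "b' \<in> set_pmf (arrival b v)" for b v b'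
    using b v b'
  proof (cases rule: arrival_cases)
    case stored
    have "heaviest_nbr G (y b) v = 0"
      using nbr_cases[of b v] stored(1)
      by (metis count_list_0_iff less_numeral_extra(3) y_def)
    then show ?thesis using stored(2) loop_le[OF b v] C by (simp add: L_append[OF v] A_def)
  next
    case (matched k)
    have "real (heaviest_nbr G (y b) v) \<le> real (count_list b (b ! k)) + C"
      using nbr_cases[of b v]
    proof
      assume "\<exists>u. adj G v u \<and> heaviest_nbr G (y b) v = y b u \<and> 0 < y b u"
      then obtain u where u: "adj G v u" "heaviest_nbr G (y b) v = y b u" by blast
      have "real (y b u) \<le> real (count_list b u)" by (simp add: y_def)
      also have "\<dots> \<le> real (count_list b (b ! k)) + C"
        by (rule greedy[OF b v matched(5,2) u(1)])
      finally show ?thesis by (simp add: u)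
    qed (use C in simp)
    moreover have "b ! k \<in> nodes G" using matched(3) adj_nodes[OF multigraph] by blast
    ultimately show ?thesis using matched(1,4) by (simp add: L_remove A_def)
  qed
  have drift: "measure_pmf.expectation (buf_kernel b) L \<le> L b + A - 2 * \<epsilon> * real (M b)"
    if b: "b \<in> buffers G" for b
  proof -
    have "measure_pmf.expectation (buf_kernel b) L
        \<le> (\<Sum>v\<in>nodes G. pmf \<mu> v * (L b + A + 2 * real (y b v) - 2 * real (heaviest_nbr G (y b) v)))"
      by (intro expectation_kernel_le b step)
    also have "\<dots> = L b + A + 2 * ((\<Sum>v\<in>nodes G. pmf \<mu> v * real (y b v))
        - (\<Sum>v\<in>nodes G. pmf \<mu> v * real (heaviest_nbr G (y b) v)))"
    proof -
      have "pmf \<mu> v * (L b + A + 2 * real (y b v) - 2 * real (heaviest_nbr G (y b) v))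
          = pmf \<mu> v * (L b + A) + 2 * (pmf \<mu> v * real (y b v))
            - 2 * (pmf \<mu> v * real (heaviest_nbr G (y b) v))" for v
        by (simp add: algebra_simps)
      then show ?thesis
        by (simp add: sum.distrib sum_subtractf sum_pmf_nodes
            flip: sum_distrib_left sum_distrib_right)
    qed
    also have "\<dots> \<le> L b + A - 2 * \<epsilon> * real (M b)"
      using Ncond_weighted[where y = "y b", OF gap y_indep[OF b]] unfolding M_def by simp
    finally show ?thesis .
  qed
  define F where "F = {b \<in> buffers G. 2 * \<epsilon> * real (M b) \<le> A + 1}"
  have "finite F"
  proof (rule finite_subset)
    show "F \<subseteq> {b \<in> buffers G. \<forall>v\<in>nodes G. count_list b v \<le> nat \<lceil>(A + 1) / (2 * \<epsilon>)\<rceil> + 1}"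
    proof safe
      fix b v assume b: "b \<in> F" and v: "v \<in> nodes G"
      have "y b v \<le> M b" unfolding M_def using finite_nodes v by (intro Max_ge) auto
      moreover have "real (M b) \<le> (A + 1) / (2 * \<epsilon>)"
        using b \<epsilon> by (simp add: F_def field_simps)
      then have "M b \<le> nat \<lceil>(A + 1) / (2 * \<epsilon>)\<rceil>" by linarith
      moreover have "b \<in> buffers G" using b by (simp add: F_def)
      ultimately show "count_list b v \<le> nat \<lceil>(A + 1) / (2 * \<epsilon>)\<rceil> + 1"
        using loop_le[OF _ v, of b] by linarith
    qed (simp add: F_def)
  qed (rule finite_bounded_buffers[OF multigraph])
  have nbr: "\<exists>v. adj G u v" if "u \<in> nodes G" for u
    by (rule exists_neighbor[OF multigraph G that])
  have "positive_recurrent_state buf_kernel z" if z: "z \<in> buffers G" for z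
  proof (rule foster[OF _ \<open>finite F\<close> _ _ z irreducible[OF nbr _ z]])
    show "0 \<le> L b" for b by (simp add: L_def sum_nonneg)
    show "F \<subseteq> buffers G" by (auto simp: F_def)
    show "measure_pmf.expectation (buf_kernel b) L \<le> L b - 1 + (if b \<in> F then A + 1 else 0)"
      if b: "b \<in> buffers G" for b
    proof -
      have "0 \<le> 2 * \<epsilon> * real (M b)" using \<epsilon> by simp
      then show ?thesis using drift[OF b] b by (simp add: F_def)
    qed
  qed
  then show ?thesis unfolding positive_recurrent_on_def by blast
qed

end

section \<open>Max-Weight policies\<close>

text \<open>An item of class \<open>v\<close> cannot be stored together with one of a different class adjacent to \<open>v\<close>, so the
  weight of an available edge only counts the queue at its other endpoint.\<close>

lemma edge_count:
  assumes "b \<in> buffers G" "adj G v u" "u \<in> set b"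
  shows "(\<Sum>i\<in>{v, u}. count_list b i) = count_list b u"
proof (cases "u = v")
  case False
  then have "v \<notin> set b" using buffers_adjE[OF assms(1), of u v] assms by (auto simp: adj_sym)
  with False show ?thesis by simp
qed simp

lemma max_weight_edges_props:
  assumes "multigraph G" "set b \<inter> nbhd G {v} \<noteq> {}"
  shows "finite (max_weight_edges G \<beta> w b v)" "max_weight_edges G \<beta> w b v \<noteq> {}"
proof -
  have fin: "finite (available_edges G b v)"
    using finite_edges[OF assms(1)] unfolding available_edges_def by simp
  then show "finite (max_weight_edges G \<beta> w b v)" unfolding max_weight_edges_def by simp
  obtain u where "u \<in> set b" "adj G v u" using assms(2) unfolding nbhd_def by blast
  then have "{v, u} \<in> available_edges G b v"
    unfolding available_edges_def adj_def by (auto simp: neq0_conv[symmetric] count_list_0_iff)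
  then have "Max (edge_weight \<beta> w b ` available_edges G b v) \<in> edge_weight \<beta> w b ` available_edges G b v"
    using fin by (intro Max_in) auto
  then obtain S where "S \<in> available_edges G b v"
      "edge_weight \<beta> w b S = Max (edge_weight \<beta> w b ` available_edges G b v)" by auto
  with fin have "S \<in> max_weight_edges G \<beta> w b v" unfolding max_weight_edges_def by auto
  then show "max_weight_edges G \<beta> w b v \<noteq> {}" by blast
qed

text \<open>For \<open>S = {v, j}\<close> the least position \<open>k\<close> with \<open>S = {v, b ! k}\<close> is that of the oldest item of class \<open>j\<close>;
  it exists because \<open>S\<close> is available.\<close>

lemma max_weight_position:
  assumes "multigraph G" "set b \<inter> nbhd G {v} \<noteq> {}" "k \<in> set_pmf (max_weight G \<beta> w b v)"
  shows "k < length b" "{v, b ! k} \<in> max_weight_edges G \<beta> w b v"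
proof -
  obtain S where S: "S \<in> max_weight_edges G \<beta> w b v"
      and k: "k = (LEAST k. k < length b \<and> S = {v, b ! k})"
    using assms(3) max_weight_edges_props[OF assms(1,2)] unfolding max_weight_def by auto
  then obtain j where j: "S = {v, j}" "count_list b j > 0"
    unfolding max_weight_edges_def available_edges_def by blast
  then have "j \<in> set b" by (metis count_notin less_numeral_extra(3))
  then obtain i where "i < length b" "b ! i = j" unfolding in_set_conv_nth by blast
  with j(1) have "\<exists>k. k < length b \<and> S = {v, b ! k}" by blast
  from LeastI_ex[OF this] have "k < length b \<and> S = {v, b ! k}" unfolding k .
  with S show "k < length b" "{v, b ! k} \<in> max_weight_edges G \<beta> w b v" by simp_all
qed

text \<open>Dividing the comparison of the edge weights by \<open>\<beta>\<close> compares the queue lengths, up to the difference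
  of two rewards.\<close>

lemma max_weight_greedy:
  assumes G: "multigraph G" and b: "b \<in> buffers G" and \<beta>: "\<beta> > 0"
    and av: "set b \<inter> nbhd G {v} \<noteq> {}" and k: "k \<in> set_pmf (max_weight G \<beta> w b v)"
    and u: "adj G v u"
  shows "real (count_list b u) \<le> real (count_list b (b ! k)) + 2 * (\<Sum>S\<in>edges G. \<bar>w S\<bar>) / \<beta>"
proof -
  define W where "W = (\<Sum>S\<in>edges G. \<bar>w S\<bar>)"
  have W: "\<bar>w S\<bar> \<le> W" if "S \<in> edges G" for S
    unfolding W_def using finite_edges[OF G] that by (intro member_le_sum) auto
  have W0: "0 \<le> W" unfolding W_def by (simp add: sum_nonneg)
  show ?thesis
  proof (cases "u \<in> set b")
    case True
    note pos = max_weight_position[OF G av k]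
    have avail: "{v, u} \<in> available_edges G b v"
      using True u unfolding available_edges_def adj_def
      by (auto simp: neq0_conv[symmetric] count_list_0_iff)
    have adj_k: "adj G v (b ! k)"
      using pos(2) unfolding max_weight_edges_def available_edges_def adj_def by blast
    have "edge_weight \<beta> w b {v, u} \<le> edge_weight \<beta> w b {v, b ! k}"
      using pos(2) avail unfolding max_weight_edges_def by blast
    then have "\<beta> * real (count_list b u) + w {v, u} \<le> \<beta> * real (count_list b (b ! k)) + w {v, b ! k}"
      unfolding edge_weight_def edge_count[OF b u True] edge_count[OF b adj_k nth_mem[OF pos(1)]] .
    moreover have "\<bar>w {v, u}\<bar> \<le> W" "\<bar>w {v, b ! k}\<bar> \<le> W"
      using u adj_k by (auto intro!: W simp: adj_def)
    ultimately have "\<beta> * real (count_list b u) \<le> \<beta> * real (count_list b (b ! k)) + 2 * W" by linarith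
    then show ?thesis using \<beta> by (simp add: W_def[symmetric] field_simps)
  qed (use W0 \<beta> in \<open>simp add: W_def\<close>)
qed

lemma max_weight_matching_model:
  assumes G: "multigraph G" and \<mu>: "\<mu> \<in> full_support_measures G"
  shows "matching_model G (max_weight G \<beta> w) \<mu>"
proof
  show "finite (set_pmf (max_weight G \<beta> w b v))" if "set b \<inter> nbhd G {v} \<noteq> {}" for b v
    using max_weight_edges_props[OF G that] unfolding max_weight_def by simp
  show "k < length b \<and> adj G v (b ! k)"
    if "set b \<inter> nbhd G {v} \<noteq> {}" "k \<in> set_pmf (max_weight G \<beta> w b v)" for b v k
    using max_weight_position[OF G that]
    unfolding max_weight_edges_def available_edges_def adj_def by blast
qed (use assms in \<open>auto simp: full_support_measures_def\<close>)

theorem theorem5p2: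
  fixes G :: "'v multigraph" and \<beta> :: real and w :: "'v set \<Rightarrow> real"
  assumes "\<beta> > 0"
    and "multigraph G"
    and "connected_multigraph G"
    and "\<not> bipartite_graph G"
  shows "Stab G (max_weight G \<beta> w) = Ncond G"
proof (rule set_eqI)
  fix \<mu> :: "'v pmf"
  show "\<mu> \<in> Stab G (max_weight G \<beta> w) \<longleftrightarrow> \<mu> \<in> Ncond G"
  proof (cases "\<mu> \<in> full_support_measures G")
    case True
    interpret matching_model G "max_weight G \<beta> w" \<mu>
      by (rule max_weight_matching_model[OF assms(2) True])
    have "0 \<le> 2 * (\<Sum>S\<in>edges G. \<bar>w S\<bar>) / \<beta>" using assms(1) by (simp add: sum_nonneg)
    then have "positive_recurrent_on (buffers G) buf_kernel" if "\<mu> \<in> Ncond G"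
      by (rule Ncond_imp_stable[OF assms(3,4) that])
         (rule max_weight_greedy[OF assms(2) _ assms(1)])
    with stable_imp_Ncond[OF assms(3,4)] True show ?thesis unfolding Stab_def by blast
  qed (simp add: Stab_def Ncond_def)
qed

end
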